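(* Let $(\mathbb R^2/\Gamma,g)$ be a Riemannian torus, $g=e^{2\mu}(dx^2+dy^2)$ in global isothermal coordinates, with Gaussian curvature $K$ and the 1-pseudoform $\Lambda=(\Lambda_1,\Lambda_2)$ of weight 3 defined in the context. If the torus admits a rank 3 irreducible Killing tensor field, then there exists a constant real pseudovector $c=(c^1,c^2)\neq0$ of weight 3 such that the system $$(\nabla^\perp K)u=c^1\Lambda_1+c^2\Lambda_2,\qquad \tfrac12\Delta^2u+\mathrm{div}(K\nabla u)=-c^2\Lambda_1+c^1\Lambda_2$$ has a solution $u\in C^\infty(\mathbb R^2)$ whose partial derivatives $u_x,u_y$ are $\Gamma$-periodic.
   Context: Killing tensor field: symmetric tensor field $f$ with $\sigma\nabla f=0$ ($\sigma$ symmetrization, $\nabla$ Levi-Civita); irreducible (rank 3): not a finite sum of symmetric products of Killing fields of positive ranks. Global isothermal coordinates: $\Gamma\subset\mathbb R^2$ a lattice, $g=e^{2\mu}(dx^2+dy^2)$ with $\mu$ smooth $\Gamma$-periodic; unique up to $z=az'+b$ for a fixed orientation, and the coordinates are taken compatible with the orientation. $\nabla^\perp K$ is the vector field obtained from the gradient $\nabla K$ by rotation through the right angle in the positive direction, acting on $u$ as a derivation; $\Delta$ is the Laplace–Beltrami operator, $\mathrm{div}$ the Riemannian divergence. A pseudovector of weight $k$: to each such system a pair $(c^1,c^2)$ with $c^1+ic^2=a^k(c'^1+ic'^2)$, $c^1-ic^2=\bar a^k(c'^1-ic'^2)$ under $z=az'$. $\Lambda$ is given in global isothermal coordinates by $\Lambda_1=\mu_{xxx}-3\mu_{xyy}+10\mu_x\mu_{xx}-20\mu_y\mu_{xy}-10\mu_x\mu_{yy}+8\mu_x^3-24\mu_x\mu_y^2$,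 $\Lambda_2=3\mu_{xxy}-\mu_{yyy}+10\mu_y\mu_{xx}+20\mu_x\mu_{xy}-10\mu_y\mu_{yy}+24\mu_x^2\mu_y-8\mu_y^3$. *)

theory Defs
  imports "HOL-Analysis.Analysis" "HOL-Library.Multiset"
begin

definition dx :: "(real \<times> real \<Rightarrow> real) \<Rightarrow> real \<times> real \<Rightarrow> real" where
  "dx f = (\<lambda>(x,y). deriv (\<lambda>t. f (t,y)) x)"

definition dy :: "(real \<times> real \<Rightarrow> real) \<Rightarrow> real \<times> real \<Rightarrow> real" where
  "dy f = (\<lambda>(x,y). deriv (\<lambda>t. f (x,t)) y)"

definition pd :: "nat \<Rightarrow> (real \<times> real \<Rightarrow> real) \<Rightarrow> real \<times> real \<Rightarrow> real" where
  "pd k f = (if k = 0 then dx f else dy f)"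

coinductive smooth :: "(real \<times> real \<Rightarrow> real) \<Rightarrow> bool" where
  "continuous_on UNIV f \<Longrightarrow>
   (\<forall>x y. (\<lambda>t. f (t,y)) differentiable (at x)) \<Longrightarrow>
   (\<forall>x y. (\<lambda>t. f (x,t)) differentiable (at y)) \<Longrightarrow>
   smooth (dx f) \<Longrightarrow> smooth (dy f) \<Longrightarrow> smooth f"

definition lattice_basis :: "real \<times> real \<Rightarrow> real \<times> real \<Rightarrow> bool" where
  "lattice_basis a b \<longleftrightarrow> fst a * snd b - snd a * fst b \<noteq> 0"

definition periodic :: "real \<times> real \<Rightarrow> real \<times> real \<Rightarrow> (real \<times> real \<Rightarrow> real) \<Rightarrow> bool" where
  "periodic a b f \<longleftrightarrow> (\<forall>x y. f (x + fst a, y + snd a) = f (x,y) \<and> f (x + fst b, y + snd b) = f (x,y))"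

definition gm :: "(real \<times> real \<Rightarrow> real) \<Rightarrow> nat \<Rightarrow> nat \<Rightarrow> real \<times> real \<Rightarrow> real" where
  "gm \<mu> i j = (\<lambda>p. if i = j then exp (2 * \<mu> p) else 0)"

definition ginv :: "(real \<times> real \<Rightarrow> real) \<Rightarrow> nat \<Rightarrow> nat \<Rightarrow> real \<times> real \<Rightarrow> real" where
  "ginv \<mu> i j = (\<lambda>p. if i = j then exp (- 2 * \<mu> p) else 0)"

definition Chr :: "(real \<times> real \<Rightarrow> real) \<Rightarrow> nat \<Rightarrow> nat \<Rightarrow> nat \<Rightarrow> real \<times> real \<Rightarrow> real" where
  "Chr \<mu> k i j = (\<lambda>p. (1/2) * (\<Sum>l<2. ginv \<mu> k l p *
      (pd i (gm \<mu> j l) p + pd j (gm \<mu> i l) p - pd l (gm \<mu> i j) p)))"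

(* covariant tensor fields: components indexed by lists of indices in {0,1} *)
type_synonym tfield = "nat list \<Rightarrow> real \<times> real \<Rightarrow> real"

definition idx :: "nat \<Rightarrow> nat list set" where
  "idx m = {xs. length xs = m \<and> set xs \<subseteq> {0,1}}"

definition cov :: "(real \<times> real \<Rightarrow> real) \<Rightarrow> nat \<Rightarrow> tfield \<Rightarrow> tfield" where
  "cov \<mu> m f = (\<lambda>xs p. case xs of [] \<Rightarrow> 0
     | (k # is) \<Rightarrow> pd k (f is) p
         - (\<Sum>j<m. \<Sum>l<2. Chr \<mu> l k (is ! j) p * f (is[j := l]) p))"

definition symz :: "nat \<Rightarrow> tfield \<Rightarrow> tfield" where
  "symz n h = (\<lambda>xs p. (1 / fact n) *
     (\<Sum>\<pi> \<in> {\<pi>. \<pi> permutes {..<n}}. h (map (\<lambda>j. xs ! \<pi> j) [0..<n]) p))"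

definition tprod :: "nat \<Rightarrow> tfield \<Rightarrow> tfield \<Rightarrow> tfield" where
  "tprod m f h = (\<lambda>xs p. f (take m xs) p * h (drop m xs) p)"

definition sprod :: "nat \<times> tfield \<Rightarrow> nat \<times> tfield \<Rightarrow> nat \<times> tfield" where
  "sprod F H = (fst F + fst H, symz (fst F + fst H) (tprod (fst F) (snd F) (snd H)))"

definition killing :: "(real \<times> real \<Rightarrow> real) \<Rightarrow> real \<times> real \<Rightarrow> real \<times> real \<Rightarrow> nat \<Rightarrow> tfield \<Rightarrow> bool" where
  "killing \<mu> a b m f \<longleftrightarrow>
     (\<forall>xs \<in> idx m. smooth (f xs) \<and> periodic a b (f xs)) \<and>
     (\<forall>xs \<in> idx m. \<forall>ys. mset ys = mset xs \<longrightarrow> f ys = f xs) \<and>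
     (\<forall>xs \<in> idx (Suc m). symz (Suc m) (cov \<mu> m f) xs = (\<lambda>p. 0))"

definition killing_product :: "(real \<times> real \<Rightarrow> real) \<Rightarrow> real \<times> real \<Rightarrow> real \<times> real \<Rightarrow> (nat \<times> tfield) list \<Rightarrow> bool" where
  "killing_product \<mu> a b F \<longleftrightarrow> length F \<ge> 2 \<and>
     (\<forall>G \<in> set F. fst G > 0 \<and> killing \<mu> a b (fst G) (snd G))"

definition irreducible_killing3 :: "(real \<times> real \<Rightarrow> real) \<Rightarrow> real \<times> real \<Rightarrow> real \<times> real \<Rightarrow> tfield \<Rightarrow> bool" where
  "irreducible_killing3 \<mu> a b f \<longleftrightarrow> killing \<mu> a b 3 f \<and>
     \<not> (\<exists>Fs :: (nat \<times> tfield) list list.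
          (\<forall>F \<in> set Fs. killing_product \<mu> a b F \<and> fst (foldl sprod (hd F) (tl F)) = 3) \<and>
          (\<forall>xs \<in> idx 3. \<forall>p. f xs p = (\<Sum>F \<leftarrow> Fs. snd (foldl sprod (hd F) (tl F)) xs p)))"

definition gauss_curv :: "(real \<times> real \<Rightarrow> real) \<Rightarrow> real \<times> real \<Rightarrow> real" where
  "gauss_curv \<mu> = (\<lambda>p. - exp (- 2 * \<mu> p) * (dx (dx \<mu>) p + dy (dy \<mu>) p))"

definition lap :: "(real \<times> real \<Rightarrow> real) \<Rightarrow> (real \<times> real \<Rightarrow> real) \<Rightarrow> real \<times> real \<Rightarrow> real" where
  "lap \<mu> u = (\<lambda>p. exp (- 2 * \<mu> p) * (dx (dx u) p + dy (dy u) p))"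

(* div(X) = e^{-2\<mu>} \<partial>_i(e^{2\<mu>} X^i) ;  here div(K \<nabla>u) with \<nabla>u = e^{-2\<mu>}(u_x,u_y) *)
definition div_K_grad :: "(real \<times> real \<Rightarrow> real) \<Rightarrow> (real \<times> real \<Rightarrow> real) \<Rightarrow> real \<times> real \<Rightarrow> real" where
  "div_K_grad \<mu> u = (\<lambda>p. exp (- 2 * \<mu> p) *
     (dx (\<lambda>q. gauss_curv \<mu> q * dx u q) p + dy (\<lambda>q. gauss_curv \<mu> q * dy u q) p))"

definition perp_grad_K :: "(real \<times> real \<Rightarrow> real) \<Rightarrow> (real \<times> real \<Rightarrow> real) \<Rightarrow> real \<times> real \<Rightarrow> real" where
  "perp_grad_K \<mu> u = (\<lambda>p. exp (- 2 * \<mu> p) *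
     (- dy (gauss_curv \<mu>) p * dx u p + dx (gauss_curv \<mu>) p * dy u p))"

definition Lam1 :: "(real \<times> real \<Rightarrow> real) \<Rightarrow> real \<times> real \<Rightarrow> real" where
  "Lam1 \<mu> = (\<lambda>p. dx (dx (dx \<mu>)) p - 3 * dy (dy (dx \<mu>)) p
     + 10 * dx \<mu> p * dx (dx \<mu>) p - 20 * dy \<mu> p * dy (dx \<mu>) p
     - 10 * dx \<mu> p * dy (dy \<mu>) p + 8 * (dx \<mu> p)^3 - 24 * dx \<mu> p * (dy \<mu> p)^2)"

definition Lam2 :: "(real \<times> real \<Rightarrow> real) \<Rightarrow> real \<times> real \<Rightarrow> real" where
  "Lam2 \<mu> = (\<lambda>p. 3 * dy (dx (dx \<mu>)) p - dy (dy (dy \<mu>)) p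
     + 10 * dy \<mu> p * dx (dx \<mu>) p + 20 * dx \<mu> p * dy (dx \<mu>) p
     - 10 * dy \<mu> p * dy (dy \<mu>) p + 24 * (dx \<mu> p)^2 * dy \<mu> p - 8 * (dy \<mu> p)^3)"

end

(*
With lambda = e^(2 mu) and z = x + iy, write a symmetric 3-tensor as the cubic polynomial
A p^3 + B p^2 pbar + conjugate in the complex momentum p, and the Killing equation as the vanishing of
its Poisson bracket with p pbar / lambda.  The coefficients of the bracket say
  A_zbar = 0,   (lambda B)_zbar + 3 lambda_z A + lambda A_z = 0,   Re (lambda^2 B)_z = 0.
By Liouville the periodic function A is constant.  By the last equation lambda^2 B is i u_zbar up to a
real factor, for a real function u with periodic derivatives, and the middle one becomes
(u_zbar / lambda)_zbar = - (i/2) A lambda_z.  Applying the second divergence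
lambda^(-1) d_z lambda^(-1) d_z lambda turns the left side into 1/8 of
(Delta^2 u / 2 + div (K grad u)) + i (rotated grad K) u and the right side into
- (i/8) A (Lambda_1 - i Lambda_2), which is the asserted system with c = - A.
If A = 0 then lambda B is holomorphic, hence constant, and the tensor is the symmetric product of the
metric and the Killing field with constant components lambda B; so irreducibility forces A to be nonzero.
*)
theory Submission
  imports Defs "HOL-Complex_Analysis.Complex_Analysis"
begin

subsection \<open>Calculus of smooth functions on the plane\<close>

lemma smooth_continuous: "smooth f \<Longrightarrow> continuous_on UNIV f"
  by (erule smooth.cases) auto

lemma smooth_dx: "smooth f \<Longrightarrow> smooth (dx f)" and smooth_dy: "smooth f \<Longrightarrow> smooth (dy f)"
  by (erule smooth.cases, simp)+

lemma smooth_DERIV_x: "smooth f \<Longrightarrow> ((\<lambda>t. f (t,y)) has_field_derivative dx f (x,y)) (at x)"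
  unfolding dx_def by (erule smooth.cases) (simp add: DERIV_deriv_iff_real_differentiable)

lemma smooth_DERIV_y: "smooth f \<Longrightarrow> ((\<lambda>t. f (x,t)) has_field_derivative dy f (x,y)) (at y)"
  unfolding dy_def by (erule smooth.cases) (simp add: DERIV_deriv_iff_real_differentiable)

lemma dx_eqI:
  "(\<And>x y. ((\<lambda>t. f (t,y)) has_field_derivative g (x,y)) (at x)) \<Longrightarrow> dx f = g"
  unfolding dx_def by (simp add: fun_eq_iff DERIV_imp_deriv)

lemma dy_eqI:
  "(\<And>x y. ((\<lambda>t. f (x,t)) has_field_derivative g (x,y)) (at y)) \<Longrightarrow> dy f = g"
  unfolding dy_def by (simp add: fun_eq_iff DERIV_imp_deriv)

lemma dx_const [simp]: "dx (\<lambda>p. c) = (\<lambda>p. 0)" and dy_const [simp]: "dy (\<lambda>p. c) = (\<lambda>p. 0)"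
  by (rule dx_eqI dy_eqI, simp)+

lemma dx_add: "smooth f \<Longrightarrow> smooth g \<Longrightarrow> dx (\<lambda>p. f p + g p) = (\<lambda>p. dx f p + dx g p)"
  and dy_add: "smooth f \<Longrightarrow> smooth g \<Longrightarrow> dy (\<lambda>p. f p + g p) = (\<lambda>p. dy f p + dy g p)"
  by (rule dx_eqI, (auto intro!: derivative_eq_intros smooth_DERIV_x)[1],
      rule dy_eqI, (auto intro!: derivative_eq_intros smooth_DERIV_y)[1])

lemma dx_mult:
  "smooth f \<Longrightarrow> smooth g \<Longrightarrow> dx (\<lambda>p. f p * g p) = (\<lambda>p. dx f p * g p + f p * dx g p)"
  and dy_mult:
  "smooth f \<Longrightarrow> smooth g \<Longrightarrow> dy (\<lambda>p. f p * g p) = (\<lambda>p. dy f p * g p + f p * dy g p)"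
  by (rule dx_eqI, (auto intro!: derivative_eq_intros smooth_DERIV_x)[1],
      rule dy_eqI, (auto intro!: derivative_eq_intros smooth_DERIV_y)[1])

lemma dx_exp: "smooth f \<Longrightarrow> dx (\<lambda>p. exp (f p)) = (\<lambda>p. dx f p * exp (f p))"
  and dy_exp: "smooth f \<Longrightarrow> dy (\<lambda>p. exp (f p)) = (\<lambda>p. dy f p * exp (f p))"
  by (rule dx_eqI, (auto intro!: derivative_eq_intros smooth_DERIV_x)[1],
      rule dy_eqI, (auto intro!: derivative_eq_intros smooth_DERIV_y)[1])

text \<open>Coinduction up to sums, products and exponentials: the partial derivatives of a product of smooth
  functions are only sums of products of smooth functions, so the closure is itself the invariant.\<close>

inductive smooth_hull :: "(real \<times> real \<Rightarrow> real) \<Rightarrow> bool" where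
  base: "smooth f \<Longrightarrow> smooth_hull f"
| const: "smooth_hull (\<lambda>p. c)"
| add: "smooth_hull f \<Longrightarrow> smooth_hull g \<Longrightarrow> smooth_hull (\<lambda>p. f p + g p)"
| mult: "smooth_hull f \<Longrightarrow> smooth_hull g \<Longrightarrow> smooth_hull (\<lambda>p. f p * g p)"
| exp: "smooth_hull f \<Longrightarrow> smooth_hull (\<lambda>p. exp (f p))"

text \<open>One unfolding of \<open>smooth\<close> with the partial derivatives as witnesses, so
  that the sum, product and chain rules can supply them during the induction.\<close>

definition hull_partials :: "(real \<times> real \<Rightarrow> real) \<Rightarrow> bool" where
  "hull_partials f \<longleftrightarrow> continuous_on UNIV f \<and> (\<exists>fx fy. smooth_hull fx \<and> smooth_hull fy \<and>
    (\<forall>x y. ((\<lambda>t. f (t,y)) has_field_derivative fx (x,y)) (at x)) \<and>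
    (\<forall>x y. ((\<lambda>t. f (x,t)) has_field_derivative fy (x,y)) (at y)))"

lemma hull_partialsI:
  "continuous_on UNIV f \<Longrightarrow> smooth_hull fx \<Longrightarrow> smooth_hull fy \<Longrightarrow>
    (\<And>x y. ((\<lambda>t. f (t,y)) has_field_derivative fx (x,y)) (at x)) \<Longrightarrow>
    (\<And>x y. ((\<lambda>t. f (x,t)) has_field_derivative fy (x,y)) (at y)) \<Longrightarrow> hull_partials f"
  unfolding hull_partials_def by blast

lemma hull_partialsE:
  assumes "hull_partials f"
  obtains fx fy where "continuous_on UNIV f" "smooth_hull fx" "smooth_hull fy"
    "\<And>x y. ((\<lambda>t. f (t,y)) has_field_derivative fx (x,y)) (at x)"
    "\<And>x y. ((\<lambda>t. f (x,t)) has_field_derivative fy (x,y)) (at y)"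
  using assms unfolding hull_partials_def by blast

lemma smooth_hull_partials: "smooth_hull f \<Longrightarrow> hull_partials f"
proof (induction rule: smooth_hull.induct)
  case (base f)
  then show ?case
    by - (rule hull_partialsI[OF smooth_continuous smooth_hull.base[OF smooth_dx]
          smooth_hull.base[OF smooth_dy] smooth_DERIV_x smooth_DERIV_y])
next
  case (const c)
  show ?case
    by (rule hull_partialsI[OF _ smooth_hull.const smooth_hull.const DERIV_const DERIV_const]) simp
next
  case (add f g)
  obtain fx fy where f: "continuous_on UNIV f" "smooth_hull fx" "smooth_hull fy"
    "\<And>x y. ((\<lambda>t. f (t,y)) has_field_derivative fx (x,y)) (at x)"
    "\<And>x y. ((\<lambda>t. f (x,t)) has_field_derivative fy (x,y)) (at y)"
    by (rule hull_partialsE[OF add.IH(1)]) blast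
  obtain gx gy where g: "continuous_on UNIV g" "smooth_hull gx" "smooth_hull gy"
    "\<And>x y. ((\<lambda>t. g (t,y)) has_field_derivative gx (x,y)) (at x)"
    "\<And>x y. ((\<lambda>t. g (x,t)) has_field_derivative gy (x,y)) (at y)"
    by (rule hull_partialsE[OF add.IH(2)]) blast
  show ?case
    by (rule hull_partialsI[OF continuous_on_add[OF f(1) g(1)] smooth_hull.add[OF f(2) g(2)]
          smooth_hull.add[OF f(3) g(3)] DERIV_add[OF f(4) g(4)] DERIV_add[OF f(5) g(5)]])
next
  case (mult f g)
  obtain fx fy where f: "continuous_on UNIV f" "smooth_hull fx" "smooth_hull fy"
    "\<And>x y. ((\<lambda>t. f (t,y)) has_field_derivative fx (x,y)) (at x)"
    "\<And>x y. ((\<lambda>t. f (x,t)) has_field_derivative fy (x,y)) (at y)"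
    by (rule hull_partialsE[OF mult.IH(1)]) blast
  obtain gx gy where g: "continuous_on UNIV g" "smooth_hull gx" "smooth_hull gy"
    "\<And>x y. ((\<lambda>t. g (t,y)) has_field_derivative gx (x,y)) (at x)"
    "\<And>x y. ((\<lambda>t. g (x,t)) has_field_derivative gy (x,y)) (at y)"
    by (rule hull_partialsE[OF mult.IH(2)]) blast
  note hull_mult = smooth_hull.add[OF smooth_hull.mult smooth_hull.mult]
  show ?case
    by (rule hull_partialsI[OF continuous_on_mult[OF f(1) g(1)]
          hull_mult[OF f(2) mult.hyps(2) g(2) mult.hyps(1)] hull_mult[OF f(3) mult.hyps(2) g(3) mult.hyps(1)]
          DERIV_mult[OF f(4) g(4)] DERIV_mult[OF f(5) g(5)]])
next
  case (exp f)
  obtain fx fy where f: "continuous_on UNIV f" "smooth_hull fx" "smooth_hull fy"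
    "\<And>x y. ((\<lambda>t. f (t,y)) has_field_derivative fx (x,y)) (at x)"
    "\<And>x y. ((\<lambda>t. f (x,t)) has_field_derivative fy (x,y)) (at y)"
    by (rule hull_partialsE[OF exp.IH]) blast
  note hull_exp = smooth_hull.mult[OF smooth_hull.exp[OF exp.hyps]]
  show ?case
    by (rule hull_partialsI[OF continuous_on_exp[OF f(1)] hull_exp[OF f(2)] hull_exp[OF f(3)]
          DERIV_fun_exp[OF f(4)] DERIV_fun_exp[OF f(5)]])
qed

text \<open>\<open>smooth_hull\<close> is the coinduction invariant; uniqueness of derivatives
  identifies the witnesses with \<open>dx f\<close> and \<open>dy f\<close>.\<close>

lemma smooth_hull_smooth: "smooth_hull f \<Longrightarrow> smooth f"
proof (coinduction arbitrary: f rule: smooth.coinduct)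
  case (smooth f)
  then obtain fx fy where f: "continuous_on UNIV f" "smooth_hull fx" "smooth_hull fy"
    and x: "\<And>x y. ((\<lambda>t. f (t,y)) has_field_derivative fx (x,y)) (at x)"
    and y: "\<And>x y. ((\<lambda>t. f (x,t)) has_field_derivative fy (x,y)) (at y)"
    by (rule hull_partialsE[OF smooth_hull_partials]) blast
  moreover have "dx f = fx" "dy f = fy"
    using x y by (auto intro: dx_eqI dy_eqI)
  moreover have "\<forall>x y. (\<lambda>t. f (t,y)) differentiable (at x)" "\<forall>x y. (\<lambda>t. f (x,t)) differentiable (at y)"
    using x y real_differentiable_def by blast+
  ultimately show ?case
    by auto
qed

lemma smooth_const [simp]: "smooth (\<lambda>p. c)"
  and smooth_add: "smooth f \<Longrightarrow> smooth g \<Longrightarrow> smooth (\<lambda>p. f p + g p)"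
  and smooth_mult: "smooth f \<Longrightarrow> smooth g \<Longrightarrow> smooth (\<lambda>p. f p * g p)"
  and smooth_exp: "smooth f \<Longrightarrow> smooth (\<lambda>p. exp (f p))"
  by (rule smooth_hull_smooth, intro smooth_hull.intros(2-) smooth_hull.base; assumption)+

lemma smooth_uminus: "smooth f \<Longrightarrow> smooth (\<lambda>p. - f p)"
  using smooth_mult[OF smooth_const[of "-1"], of f] by simp

lemma smooth_diff: "smooth f \<Longrightarrow> smooth g \<Longrightarrow> smooth (\<lambda>p. f p - g p)"
  using smooth_add[OF _ smooth_uminus, of f g] by simp

lemma dx_uminus: "smooth f \<Longrightarrow> dx (\<lambda>p. - f p) = (\<lambda>p. - dx f p)"
  and dy_uminus: "smooth f \<Longrightarrow> dy (\<lambda>p. - f p) = (\<lambda>p. - dy f p)"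
  by (rule dx_eqI, (auto intro!: derivative_eq_intros smooth_DERIV_x)[1],
      rule dy_eqI, (auto intro!: derivative_eq_intros smooth_DERIV_y)[1])

lemma dx_diff: "smooth f \<Longrightarrow> smooth g \<Longrightarrow> dx (\<lambda>p. f p - g p) = (\<lambda>p. dx f p - dx g p)"
  and dy_diff: "smooth f \<Longrightarrow> smooth g \<Longrightarrow> dy (\<lambda>p. f p - g p) = (\<lambda>p. dy f p - dy g p)"
  by (rule dx_eqI, (auto intro!: derivative_eq_intros smooth_DERIV_x)[1],
      rule dy_eqI, (auto intro!: derivative_eq_intros smooth_DERIV_y)[1])

lemmas smooth_intros = smooth_add smooth_mult smooth_exp smooth_uminus smooth_diff
  smooth_dx smooth_dy

lemmas partial_simps = dx_add dx_mult dx_exp dx_uminus dx_diff dy_add dy_mult dy_exp dy_uminus dy_diff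

section \<open>Symmetry of second derivatives, total derivative, Poincare lemma\<close>

text \<open>The mean value theorem is applied in the first variable to the increment of
  \<open>f\<close> in the second, then in the second variable to \<open>fx\<close>. Exchanging the
  variables gives another expression for the same difference.\<close>

lemma mixed_difference:
  fixes f :: "real \<Rightarrow> real \<Rightarrow> real"
  assumes "\<And>x y. ((\<lambda>t. f t y) has_field_derivative fx x y) (at x)"
    and "\<And>x y. ((\<lambda>t. fx x t) has_field_derivative fxy x y) (at y)" and "h > 0"
  shows "\<exists>\<xi> \<eta>. x < \<xi> \<and> \<xi> < x + h \<and> y < \<eta> \<and> \<eta> < y + h \<and>
    f (x + h) (y + h) - f (x + h) y - f x (y + h) + f x y = h * h * fxy \<xi> \<eta>"
proof -
  have "\<exists>\<xi>. \<xi> > x \<and> \<xi> < x + h \<and> (f (x + h) (y + h) - f (x + h) y) - (f x (y + h) - f x y)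
      = (x + h - x) * (fx \<xi> (y + h) - fx \<xi> y)"
    by (rule MVT2) (use assms in \<open>auto intro!: derivative_eq_intros\<close>)
  then obtain \<xi> where \<xi>: "\<xi> > x" "\<xi> < x + h"
    "(f (x + h) (y + h) - f (x + h) y) - (f x (y + h) - f x y) = h * (fx \<xi> (y + h) - fx \<xi> y)"
    by auto
  have "\<exists>\<eta>. \<eta> > y \<and> \<eta> < y + h \<and> fx \<xi> (y + h) - fx \<xi> y = (y + h - y) * fxy \<xi> \<eta>"
    by (rule MVT2) (use assms in auto)
  then obtain \<eta> where "\<eta> > y" "\<eta> < y + h" "fx \<xi> (y + h) - fx \<xi> y = h * fxy \<xi> \<eta>"
    by auto
  with \<xi> show ?thesis
    by (intro exI[of _ \<xi>] exI[of _ \<eta>]) (auto simp: algebra_simps)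
qed

text \<open>The second difference over a square of side h, divided by h^2, is a value of either
  mixed derivative somewhere in that square. Both are continuous, so they agree in the limit h =
  1/(n+1).\<close>

lemma mixed_partials:
  assumes "smooth f"
  shows "dx (dy f) = dy (dx f)"
proof
  fix p :: "real \<times> real"
  obtain x y where p: "p = (x,y)" by force
  have lim: "(\<lambda>n. g (s n, t n)) \<longlonglongrightarrow> g (x,y)"
    if "smooth g" and s: "\<And>n. x < s n \<and> s n < x + inverse (real (Suc n))"
      and t: "\<And>n. y < t n \<and> t n < y + inverse (real (Suc n))" for g s t
  proof -
    have *: "r \<longlonglongrightarrow> c" if r: "\<And>n. c < r n \<and> r n < c + inverse (real (Suc n))" for r :: "nat \<Rightarrow> real" and c
    proof (rule tendsto_sandwich)
      show "(\<lambda>n. c) \<longlonglongrightarrow> c" by simp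
      show "(\<lambda>n. c + inverse (real (Suc n))) \<longlonglongrightarrow> c"
        using tendsto_add[OF tendsto_const[of c] LIMSEQ_inverse_real_of_nat] by simp
    qed (use r in \<open>auto intro!: always_eventually less_imp_le\<close>)
    have "isCont g (x,y)"
      using smooth_continuous[OF that(1)] by (simp add: continuous_on_eq_continuous_at)
    then show ?thesis
      by (rule isCont_tendsto_compose) (intro tendsto_Pair *[OF s] *[OF t])
  qed
  define D where "D = (\<lambda>h. f (x + h, y + h) - f (x + h, y) - f (x, y + h) + f (x,y))"
  have "\<exists>s t. (x < s \<and> s < x + inverse (real (Suc n))) \<and> (y < t \<and> t < y + inverse (real (Suc n))) \<and>
      D (inverse (real (Suc n))) = inverse (real (Suc n)) * inverse (real (Suc n)) * dy (dx f) (s,t)" for n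
    using mixed_difference[of "\<lambda>x y. f (x,y)" "\<lambda>x y. dx f (x,y)" "\<lambda>x y. dy (dx f) (x,y)",
        OF smooth_DERIV_x[OF assms] smooth_DERIV_y[OF smooth_dx[OF assms]], of "inverse (real (Suc n))" x y]
    unfolding D_def by auto
  then obtain s t where st: "\<And>n. x < s n \<and> s n < x + inverse (real (Suc n))"
      "\<And>n. y < t n \<and> t n < y + inverse (real (Suc n))"
      "\<And>n. D (inverse (real (Suc n))) = inverse (real (Suc n)) * inverse (real (Suc n)) * dy (dx f) (s n,t n)"
    by metis
  have "\<exists>s t. (x < s \<and> s < x + inverse (real (Suc n))) \<and> (y < t \<and> t < y + inverse (real (Suc n))) \<and>
      D (inverse (real (Suc n))) = inverse (real (Suc n)) * inverse (real (Suc n)) * dx (dy f) (s,t)" for n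
  proof -
    \<comment> \<open>Here \<open>f\<close> is read with its arguments exchanged, which only swaps
      the two middle terms of \<open>D\<close>.\<close>
    obtain t s where "y < t" "t < y + inverse (real (Suc n))" "x < s" "s < x + inverse (real (Suc n))"
      "f (x + inverse (real (Suc n)), y + inverse (real (Suc n))) - f (x, y + inverse (real (Suc n)))
        - f (x + inverse (real (Suc n)), y) + f (x,y)
        = inverse (real (Suc n)) * inverse (real (Suc n)) * dx (dy f) (s,t)"
      using mixed_difference[of "\<lambda>y x. f (x,y)" "\<lambda>y x. dy f (x,y)" "\<lambda>y x. dx (dy f) (x,y)",
          OF smooth_DERIV_y[OF assms] smooth_DERIV_x[OF smooth_dy[OF assms]], of "inverse (real (Suc n))" y x]
      by auto
    then show ?thesis
      unfolding D_def by (intro exI[of _ s] exI[of _ t]) linarith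
  qed
  then obtain s' t' where st': "\<And>n. x < s' n \<and> s' n < x + inverse (real (Suc n))"
      "\<And>n. y < t' n \<and> t' n < y + inverse (real (Suc n))"
      "\<And>n. D (inverse (real (Suc n))) = inverse (real (Suc n)) * inverse (real (Suc n)) * dx (dy f) (s' n,t' n)"
    by metis
  have "dx (dy f) (s' n,t' n) = dy (dx f) (s n,t n)" for n
    using st(3)[of n] st'(3)[of n] by simp
  then have "(\<lambda>n. dx (dy f) (s' n,t' n)) = (\<lambda>n. dy (dx f) (s n,t n))"
    by blast
  then show "dx (dy f) p = dy (dx f) p"
    unfolding p using lim[OF _ st(1,2), of "dy (dx f)"] lim[OF _ st'(1,2), of "dx (dy f)"]
    by (auto intro: smooth_dx smooth_dy assms LIMSEQ_unique)
qed

text \<open>An \<open>x\<close>-derivative together with a continuous \<open>y\<close>-derivative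
  gives total differentiability. This supplies the chain rule along rays and, later, complex
  differentiability.\<close>

lemma smooth_has_derivative:
  assumes "smooth f"
  shows "(f has_derivative (\<lambda>h. fst h * dx f p + snd h * dy f p)) (at p)"
proof -
  obtain x y where p: "p = (x,y)" by force
  have cont: "continuous (at (x, y)) (\<lambda>(x, y). blinfun_scaleR_left (dy f (x,y)))"
    using smooth_continuous[OF smooth_dy[OF assms]]
    by (auto simp: continuous_on_eq_continuous_at case_prod_unfold
        intro!: bounded_linear.continuous[OF bounded_linear_blinfun_scaleR_left])
  have Dx: "((\<lambda>x. f (x,y)) has_derivative (\<lambda>h. dx f (x,y) * h)) (at x within UNIV)" for x y
    using smooth_DERIV_x[OF assms] by (simp add: has_field_derivative_def)
  have Dy: "((\<lambda>y. f (x,y)) has_derivative blinfun_apply (blinfun_scaleR_left (dy f (x,y)))) (at y within UNIV)" for x y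
    using smooth_DERIV_y[OF assms, of x y] by (auto simp: has_field_derivative_def elim!: has_derivative_eq_rhs)
  have "((\<lambda>(x, y). f (x,y)) has_derivative
      (\<lambda>(tx, ty). dx f (x,y) * tx + blinfun_apply (blinfun_scaleR_left (dy f (x,y))) ty)) (at (x, y) within UNIV \<times> UNIV)"
    by (rule has_derivative_partialsI[OF Dx Dy]) (use cont in simp_all)
  then show ?thesis
    by (simp add: p case_prod_unfold mult.commute)
qed

text \<open>Poincare lemma: the potential is the integral of \<open>P dx + Q dy\<close> along the
  segment from the origin, differentiated under the integral sign.\<close>

lemma closed_form_potential:
  assumes P: "smooth P" and Q: "smooth Q" and eq: "dy P = dx Q"
  shows "\<exists>u. smooth u \<and> dx u = P \<and> dy u = Q"
proof -
  \<comment> \<open>The form at \<open>(t x, t y)\<close> applied to the velocity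
    \<open>(x, y)\<close> of the segment.\<close>
  define F where "F = (\<lambda>x y t. x * P (t * x, t * y) + y * Q (t * x, t * y))"
  define u where "u = (\<lambda>p. integral {0..1} (F (fst p) (snd p)))"
  have Pc: "continuous_on UNIV P" and Qc: "continuous_on UNIV Q"
    using P Q by (auto intro: smooth_continuous)
  have along: "((\<lambda>t. R (t * x, t * y)) has_field_derivative x * dx R (t * x, t * y) + y * dy R (t * x, t * y)) (at t)"
    if "smooth R" for R x y t
    unfolding has_field_derivative_def
    by (rule has_derivative_eq_rhs[OF has_derivative_compose[OF _ smooth_has_derivative[OF that]]])
      (auto intro!: derivative_eq_intros simp: algebra_simps)
  have scale_x: "((\<lambda>x. R (t * x, t * y)) has_field_derivative t * dx R (t * x, t * y)) (at x)"
    if "smooth R" for R x y t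
    using DERIV_chain2[OF smooth_DERIV_x[OF that, of "t * y" "t * x"] DERIV_cmult_Id[of t x]]
    by (simp add: mult.commute)
  have scale_y: "((\<lambda>y. R (t * x, t * y)) has_field_derivative t * dy R (t * x, t * y)) (at y)"
    if "smooth R" for R x y t
    using DERIV_chain2[OF smooth_DERIV_y[OF that, of "t * x" "t * y"] DERIV_cmult_Id[of t y]]
    by (simp add: mult.commute)
  \<comment> \<open>For a closed form the integrand of either partial derivative of \<open>u\<close> is \<open>d/dt (t R (t x, t y))\<close>.\<close>
  have ftc: "integral (cbox 0 1) (\<lambda>t. R (t * x, t * y) + t * (x * dx R (t * x, t * y) + y * dy R (t * x, t * y)))
      = R (x,y)" if "smooth R" for R x y
  proof -
    have "((\<lambda>t. t * R (t * x, t * y)) has_field_derivative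
        R (t * x, t * y) + t * (x * dx R (t * x, t * y) + y * dy R (t * x, t * y))) (at t)" for t
      by (rule DERIV_cong[OF DERIV_mult[OF DERIV_ident along[OF that]]]) simp
    then have "((\<lambda>t. R (t * x, t * y) + t * (x * dx R (t * x, t * y) + y * dy R (t * x, t * y)))
      has_integral 1 * R (1 * x, 1 * y) - 0 * R (0 * x, 0 * y)) {0..1}"
      by (intro fundamental_theorem_of_calculus)
        (auto simp flip: has_real_derivative_iff_has_vector_derivative intro: has_field_derivative_at_within)
    then show ?thesis by (simp add: integral_unique)
  qed
  have int: "F x y integrable_on cbox 0 1" for x y
    unfolding F_def by (rule integrable_continuous) (intro continuous_intros continuous_on_compose2[OF Pc] continuous_on_compose2[OF Qc] subset_UNIV)
  \<comment> \<open>Closedness identifies \<open>dx Q\<close> with \<open>dy P\<close>, which brings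
    the integrand into the form of \<open>ftc\<close>.\<close>
  have Fx: "((\<lambda>x. F x y t) has_field_derivative
      P (t * x, t * y) + t * (x * dx P (t * x, t * y) + y * dy P (t * x, t * y))) (at x)" for x y t
    unfolding F_def eq
    by (rule DERIV_cong[OF DERIV_add[OF DERIV_mult[OF DERIV_ident scale_x[OF P]] DERIV_cmult[OF scale_x[OF Q]]]])
      (simp add: algebra_simps)
  have Fy: "((\<lambda>y. F x y t) has_field_derivative
      Q (t * x, t * y) + t * (x * dx Q (t * x, t * y) + y * dy Q (t * x, t * y))) (at y)" for x y t
    unfolding F_def eq[symmetric]
    by (rule DERIV_cong[OF DERIV_add[OF DERIV_cmult[OF scale_y[OF P]] DERIV_mult[OF DERIV_ident scale_y[OF Q]]]])
      (simp add: algebra_simps)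
  have ux: "((\<lambda>x. u (x,y)) has_field_derivative P (x,y)) (at x)" for x y
  proof -
    have cont: "continuous_on (UNIV \<times> cbox 0 1) (\<lambda>q. P (snd q * fst q, snd q * y) +
        snd q * (fst q * dx P (snd q * fst q, snd q * y) + y * dy P (snd q * fst q, snd q * y)))"
      by (intro continuous_on_add continuous_on_mult continuous_on_fst continuous_on_snd continuous_on_const
          continuous_on_id continuous_on_compose2[OF smooth_continuous[OF P]]
          continuous_on_compose2[OF smooth_continuous[OF smooth_dx[OF P]]]
          continuous_on_compose2[OF smooth_continuous[OF smooth_dy[OF P]]] continuous_on_Pair subset_UNIV)
    have "((\<lambda>x. integral (cbox 0 1) (F x y)) has_field_derivative
       integral (cbox 0 1) (\<lambda>t. P (t * x, t * y) + t * (x * dx P (t * x, t * y) + y * dy P (t * x, t * y)))) (at x within UNIV)"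
      by (rule leibniz_rule_field_derivative[OF Fx int _ UNIV_I convex_UNIV])
        (simp only: case_prod_unfold cont)
    then show ?thesis
      using ftc[OF P, of x y] by (simp add: u_def)
  qed
  have uy: "((\<lambda>y. u (x,y)) has_field_derivative Q (x,y)) (at y)" for x y
  proof -
    have cont: "continuous_on (UNIV \<times> cbox 0 1) (\<lambda>q. Q (snd q * x, snd q * fst q) +
        snd q * (x * dx Q (snd q * x, snd q * fst q) + fst q * dy Q (snd q * x, snd q * fst q)))"
      by (intro continuous_on_add continuous_on_mult continuous_on_fst continuous_on_snd continuous_on_const
          continuous_on_id continuous_on_compose2[OF smooth_continuous[OF Q]]
          continuous_on_compose2[OF smooth_continuous[OF smooth_dx[OF Q]]]
          continuous_on_compose2[OF smooth_continuous[OF smooth_dy[OF Q]]] continuous_on_Pair subset_UNIV)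
    have "((\<lambda>y. integral (cbox 0 1) (F x y)) has_field_derivative
       integral (cbox 0 1) (\<lambda>t. Q (t * x, t * y) + t * (x * dx Q (t * x, t * y) + y * dy Q (t * x, t * y)))) (at y within UNIV)"
      by (rule leibniz_rule_field_derivative[OF Fy int _ UNIV_I convex_UNIV])
        (simp only: case_prod_unfold cont)
    then show ?thesis
      using ftc[OF Q, of x y] by (simp add: u_def)
  qed
  have "continuous_on UNIV (\<lambda>p. integral (cbox 0 1) (\<lambda>t. F (fst p) (snd p) t))"
    by (rule integral_continuous_on_param)
      (unfold F_def case_prod_unfold, intro continuous_on_add continuous_on_mult continuous_on_fst continuous_on_snd
        continuous_on_id continuous_on_compose2[OF Pc] continuous_on_compose2[OF Qc] continuous_on_Pair subset_UNIV)
  then have "continuous_on UNIV u"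
    by (simp add: u_def)
  moreover have d: "dx u = P" "dy u = Q"
    using ux uy by (auto intro: dx_eqI dy_eqI)
  moreover have "\<forall>x y. (\<lambda>t. u (t,y)) differentiable (at x)" "\<forall>x y. (\<lambda>t. u (x,t)) differentiable (at y)"
    using ux uy real_differentiable_def by blast+
  \<comment> \<open>One unfolding suffices, since the partial derivatives \<open>P\<close> and
    \<open>Q\<close> are already smooth.\<close>
  ultimately have "smooth u"
    using P Q by - (rule smooth.intros, simp_all)
  with d show ?thesis by blast
qed

subsection \<open>Liouville's theorem on the torus\<close>

lemma periodic_int:
  assumes "periodic a b f"
  shows "f (x + of_int m * fst a + of_int n * fst b, y + of_int m * snd a + of_int n * snd b) = f (x,y)"
proof -
  have shift: "f (x + of_int m * fst c, y + of_int m * snd c) = f (x,y)"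
    if c: "\<And>x y. f (x + fst c, y + snd c) = f (x,y)" for c x y m
  proof (induction m rule: int_induct[of _ 0])
    case (step1 i)
    then show ?case using c[of "x + of_int i * fst c" "y + of_int i * snd c"] by (simp add: algebra_simps)
  next
    case (step2 i)
    then show ?case using c[of "x + of_int (i - 1) * fst c" "y + of_int (i - 1) * snd c"] by (simp add: algebra_simps)
  qed simp
  show ?thesis
    using assms shift[of a] shift[of b] by (simp add: periodic_def)
qed

text \<open>Reducing the lattice coordinates of a point to their fractional parts shows that all
  values occur on a compact fundamental parallelogram.\<close>

lemma periodic_bounded:
  assumes lat: "lattice_basis a b" and per: "periodic a b f" and cont: "continuous_on UNIV f"
  shows "bounded (range f)"
proof -
  define L where "L = (\<lambda>(s,t). (s * fst a + t * fst b, s * snd a + t * snd b))"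
  have "compact ((f \<circ> L) ` ({0..1} \<times> {0..1}))"
    unfolding L_def comp_def
    by (intro compact_continuous_image compact_Times compact_Icc)
      (auto intro!: continuous_on_compose2[OF cont] continuous_intros simp: case_prod_unfold)
  moreover have "range f \<subseteq> (f \<circ> L) ` ({0..1} \<times> {0..1})"
  proof safe
    fix x y
    define d where "d = fst a * snd b - snd a * fst b"
    have d: "d \<noteq> 0" using lat by (simp add: d_def lattice_basis_def)
    \<comment> \<open>Coordinates of \<open>(x, y)\<close> in the basis \<open>a\<close>,
      \<open>b\<close>, by Cramer's rule.\<close>
    define s t where "s = (x * snd b - y * fst b) / d" and "t = (fst a * y - snd a * x) / d"
    have "(s * fst a + t * fst b) * d = x * d" "(s * snd a + t * snd b) * d = y * d"
      using d by (simp_all add: s_def t_def distrib_right) (simp_all add: d_def algebra_simps)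
    then have st: "x = s * fst a + t * fst b" "y = s * snd a + t * snd b"
      using d by simp_all
    have "f (x,y) = f (L (frac s, frac t))"
      using periodic_int[OF per, of "frac s * fst a + frac t * fst b" "\<lfloor>s\<rfloor>" "\<lfloor>t\<rfloor>" "frac s * snd a + frac t * snd b"]
      by (simp add: st L_def frac_def algebra_simps)
    moreover have "(frac s, frac t) \<in> {0..1} \<times> {0..1}"
      by (simp add: less_imp_le frac_lt_1)
    ultimately show "f (x,y) \<in> (f \<circ> L) ` ({0..1} \<times> {0..1})"
      by force
  qed
  ultimately show ?thesis
    using bounded_subset compact_imp_bounded by blast
qed

text \<open>\<open>P + iQ\<close> is entire by the Cauchy-Riemann equations and bounded by
  periodicity, so Liouville's theorem applies.\<close>

lemma periodic_Cauchy_Riemann_constant: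
  assumes lat: "lattice_basis a b" and P: "smooth P" "periodic a b P" and Q: "smooth Q" "periodic a b Q"
    and CR: "\<And>p. dx P p = dy Q p" "\<And>p. dx Q p = - dy P p"
  shows "\<exists>c d. P = (\<lambda>p. c) \<and> Q = (\<lambda>p. d)"
proof -
  define F where "F = (\<lambda>z. Complex (P (Re z, Im z)) (Q (Re z, Im z)))"
  have "(F has_field_derivative Complex (dx P (Re z, Im z)) (dx Q (Re z, Im z))) (at z)" for z
  proof -
    have R: "((\<lambda>z. R (Re z, Im z)) has_derivative (\<lambda>h. Re h * dx R (Re z, Im z) + Im h * dy R (Re z, Im z))) (at z)"
      if "smooth R" for R
      by (rule has_derivative_eq_rhs[OF has_derivative_compose[OF _ smooth_has_derivative[OF that]]])
        (auto intro!: derivative_eq_intros)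
    show ?thesis
      unfolding has_field_derivative_def F_def Complex_eq
      by (rule has_derivative_eq_rhs)
        (auto intro!: derivative_eq_intros R P Q simp: fun_eq_iff complex_eq_iff CR algebra_simps)
  qed
  then have "F holomorphic_on UNIV"
    by (auto simp: holomorphic_on_def field_differentiable_def)
  moreover have "bounded (range F)"
  proof -
    obtain B C where "\<And>p. norm (P p) \<le> B" "\<And>p. norm (Q p) \<le> C"
      using periodic_bounded[OF lat P(2) smooth_continuous[OF P(1)]] periodic_bounded[OF lat Q(2) smooth_continuous[OF Q(1)]]
      by (auto simp: bounded_iff)
    then have "norm (F z) \<le> B + C" for z
      unfolding F_def by (intro order_trans[OF cmod_le]) (auto intro!: add_mono)
    then show ?thesis by (auto simp: bounded_iff)
  qed
  ultimately obtain w where w: "\<And>z. F z = w"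
    using Liouville_theorem by (auto simp: constant_on_def)
  have "P p = Re w" "Q p = Im w" for p
    using w[of "Complex (fst p) (snd p)"] by (auto simp: F_def)
  then show ?thesis by blast
qed

subsection \<open>Components of low-rank tensor fields\<close>

text \<open>The value of \<open>symz\<close> at a fixed point before division by the factorial; in
  this form it satisfies a recursion in \<open>n\<close>.\<close>

definition permutation_sum :: "nat \<Rightarrow> (nat list \<Rightarrow> real) \<Rightarrow> nat list \<Rightarrow> real" where
  "permutation_sum n h xs = (\<Sum>\<pi> | \<pi> permutes {..<n}. h (map (\<lambda>j. xs ! \<pi> j) [0..<n]))"

lemma permutation_sum_0: "permutation_sum 0 h xs = h []"
  by (simp add: permutation_sum_def)

text \<open>Each permutation of \<open>{..n}\<close> is a permutation of \<open>{..<n}\<close>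
  followed by the transposition of \<open>n\<close> with some \<open>b\<close>. The last argument is
  then \<open>xs ! b\<close>, and the displaced \<open>xs ! n\<close> fills position
  \<open>b\<close>.\<close>

lemma permutation_sum_Suc:
  assumes "n < length xs"
  shows "permutation_sum (Suc n) h xs =
    (\<Sum>b<Suc n. permutation_sum n (\<lambda>ys. h (ys @ [xs ! b])) (xs[b := xs ! n]))"
proof -
  have "map (\<lambda>j. xs ! (Transposition.transpose n b \<circ> \<pi>) j) [0..<Suc n]
      = map (\<lambda>j. xs[b := xs ! n] ! \<pi> j) [0..<n] @ [xs ! b]" if "\<pi> permutes {..<n}" "b < Suc n" for \<pi> b
  proof -
    have "\<pi> n = n" and less: "\<And>j. j < n \<Longrightarrow> \<pi> j < n"
      using that by (auto simp: permutes_def permutes_in_image[OF that(1), simplified])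
    moreover have "xs ! Transposition.transpose n b (\<pi> j) = xs[b := xs ! n] ! \<pi> j" if "j < n" for j
      using less[OF that] \<open>b < Suc n\<close> assms by (auto simp: Transposition.transpose_def nth_list_update)
    ultimately show ?thesis
      by simp
  qed
  then have "(\<Sum>b<Suc n. \<Sum>\<pi> | \<pi> permutes {..<n}.
      h (map (\<lambda>j. xs ! (Transposition.transpose n b \<circ> \<pi>) j) [0..<Suc n])) =
    (\<Sum>b<Suc n. permutation_sum n (\<lambda>ys. h (ys @ [xs ! b])) (xs[b := xs ! n]))"
    unfolding permutation_sum_def by (intro sum.cong refl) (metis lessThan_iff mem_Collect_eq)
  then show ?thesis
    using sum_over_permutations_insert[of "{..<n}" n "\<lambda>\<pi>. h (map (\<lambda>j. xs ! \<pi> j) [0..<Suc n])"]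
    by (simp add: permutation_sum_def[of "Suc n"] lessThan_Suc)
qed

lemma symz_permutation_sum: "symz n h xs p = permutation_sum n (\<lambda>ys. h ys p) xs / fact n"
  by (simp add: symz_def permutation_sum_def)

lemma symz_2: "symz 2 h [i,j] p = (h [i,j] p + h [j,i] p) / 2"
proof -
  have n: "2 = Suc (Suc 0)" by simp
  show ?thesis
    unfolding n by (simp add: symz_permutation_sum permutation_sum_Suc permutation_sum_0)
qed

lemma symz_3: "symz 3 h [i,j,k] p =
    (h [i,j,k] p + h [i,k,j] p + h [j,i,k] p + h [j,k,i] p + h [k,i,j] p + h [k,j,i] p) / 6"
proof -
  have n: "3 = Suc (Suc (Suc 0))" by simp
  show ?thesis
    unfolding n by (simp add: symz_permutation_sum permutation_sum_Suc permutation_sum_0)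
qed

lemma symz_4: "symz 4 h [i,j,k,l] p =
    (h [i,j,k,l] p + h [i,j,l,k] p + h [i,k,j,l] p + h [i,k,l,j] p + h [i,l,j,k] p + h [i,l,k,j] p +
     h [j,i,k,l] p + h [j,i,l,k] p + h [j,k,i,l] p + h [j,k,l,i] p + h [j,l,i,k] p + h [j,l,k,i] p +
     h [k,j,i,l] p + h [k,j,l,i] p + h [k,i,j,l] p + h [k,i,l,j] p + h [k,l,j,i] p + h [k,l,i,j] p +
     h [l,j,k,i] p + h [l,j,i,k] p + h [l,k,j,i] p + h [l,k,i,j] p + h [l,i,j,k] p + h [l,i,k,j] p) / 24"
proof -
  have n: "4 = Suc (Suc (Suc (Suc 0)))" by simp
  show ?thesis
    unfolding n by (simp add: symz_permutation_sum permutation_sum_Suc permutation_sum_0)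
qed

section \<open>Covariant derivatives and Killing equations in isothermal coordinates\<close>

lemma cov_1: "cov \<mu> 1 f [k,i] p = pd k (f [i]) p - (\<Sum>l<2. Chr \<mu> l k i p * f [l] p)"
  by (simp add: cov_def)

lemma cov_2: "cov \<mu> 2 f [k,i,j] p = pd k (f [i,j]) p -
    (\<Sum>l<2. Chr \<mu> l k i p * f [l,j] p + Chr \<mu> l k j p * f [i,l] p)"
  by (simp add: cov_def sum.distrib numeral_2_eq_2 lessThan_Suc)

lemma cov_3: "cov \<mu> 3 f [k,i,j,m] p = pd k (f [i,j,m]) p -
    (\<Sum>l<2. Chr \<mu> l k i p * f [l,j,m] p + Chr \<mu> l k j p * f [i,l,m] p + Chr \<mu> l k m p * f [i,j,l] p)"
  by (simp add: cov_def sum.distrib numeral_2_eq_2 numeral_3_eq_3 lessThan_Suc)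

text \<open>By \<open>E\<close> the inverse metric cancels the factor
  \<open>exp (2 * \<mu> p)\<close> left by differentiating the metric, so only first derivatives of
  \<open>\<mu>\<close> survive.\<close>

lemma Chr_conformal:
  assumes "smooth \<mu>" "i < 2" "j < 2" "k < 2"
  shows "Chr \<mu> k i j p = (if k = j then pd i \<mu> p else 0) + (if k = i then pd j \<mu> p else 0)
    - (if i = j then pd k \<mu> p else 0)"
proof -
  have E: "exp (- (2 * \<mu> p)) * exp (2 * \<mu> p) = 1"
    by (simp flip: exp_add)
  have "i \<in> {0,Suc 0}" "j \<in> {0,Suc 0}" "k \<in> {0,Suc 0}" using assms by auto
  then show ?thesis
    using assms(1) E
    by (auto simp: Chr_def gm_def ginv_def pd_def numeral_2_eq_2 lessThan_Suc partial_simps smooth_intros)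
qed

lemma idx_0: "idx 0 = {[]}"
  by (auto simp: idx_def)

lemma idx_Suc: "idx (Suc m) = (#) 0 ` idx m \<union> (#) (Suc 0) ` idx m"
proof -
  have "xs \<in> idx (Suc m) \<longleftrightarrow> xs \<in> (#) 0 ` idx m \<union> (#) (Suc 0) ` idx m" for xs
    by (cases xs) (auto simp: idx_def)
  then show ?thesis by blast
qed

lemma idx_1: "idx 1 = {[0],[Suc 0]}"
  by (simp add: idx_0 idx_Suc insert_commute)

lemma idx_2: "idx 2 = {[0,0],[0,Suc 0],[Suc 0,0],[Suc 0,Suc 0]}"
  unfolding numeral_2_eq_2 by (simp add: idx_0 idx_Suc insert_commute)

lemma idx_3: "idx 3 = {[0,0,0],[0,0,Suc 0],[0,Suc 0,0],[0,Suc 0,Suc 0],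
     [Suc 0,0,0],[Suc 0,0,Suc 0],[Suc 0,Suc 0,0],[Suc 0,Suc 0,Suc 0]}"
  unfolding numeral_3_eq_3 by (simp add: idx_0 idx_Suc) blast

text \<open>As rewrite rules these leave only the four components with nondecreasing
  indices.\<close>

lemma killing_3_symmetric:
  assumes "killing \<mu> a b 3 f"
  shows "f [0,Suc 0,0] = f [0,0,Suc 0]" "f [Suc 0,0,0] = f [0,0,Suc 0]"
    "f [Suc 0,0,Suc 0] = f [0,Suc 0,Suc 0]" "f [Suc 0,Suc 0,0] = f [0,Suc 0,Suc 0]"
proof -
  have "f ys = f xs" if "xs \<in> idx 3" "mset ys = mset xs" for xs ys
    using assms that unfolding killing_def by blast
  then show "f [0,Suc 0,0] = f [0,0,Suc 0]" "f [Suc 0,0,0] = f [0,0,Suc 0]"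
    "f [Suc 0,0,Suc 0] = f [0,Suc 0,Suc 0]" "f [Suc 0,Suc 0,0] = f [0,Suc 0,Suc 0]"
    by (auto simp: idx_3)
qed

text \<open>A symmetric rank 4 tensor in dimension two has five independent components, one for each
  number of indices \<open>Suc 0\<close>; each yields one equation.\<close>

lemma killing_3_equations:
  fixes f \<mu> a b
  defines "F0 \<equiv> f [0,0,0]" and "F1 \<equiv> f [0,0,Suc 0]" and "F2 \<equiv> f [0,Suc 0,Suc 0]"
    and "F3 \<equiv> f [Suc 0,Suc 0,Suc 0]"
  assumes \<mu>: "smooth \<mu>" and kill: "killing \<mu> a b 3 f"
  shows "dx F0 p = 3 * dx \<mu> p * F0 p - 3 * dy \<mu> p * F1 p"
    "dy F0 p + 3 * dx F1 p = 6 * dy \<mu> p * F0 p + 12 * dx \<mu> p * F1 p - 6 * dy \<mu> p * F2 p"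
    "dx F2 p + dy F1 p = 5 * dx \<mu> p * F2 p + 5 * dy \<mu> p * F1 p - dy \<mu> p * F3 p - dx \<mu> p * F0 p"
    "dx F3 p + 3 * dy F2 p = 12 * dy \<mu> p * F2 p + 6 * dx \<mu> p * F3 p - 6 * dx \<mu> p * F1 p"
    "dy F3 p = 3 * dy \<mu> p * F3 p - 3 * dx \<mu> p * F2 p"
proof -
  have "symz 4 (cov \<mu> 3 f) xs p = 0" if "xs \<in> idx (Suc 3)" for xs
    using kill that unfolding killing_def by simp
  then have S: "symz 4 (cov \<mu> 3 f) [0,0,0,0] p = 0" "symz 4 (cov \<mu> 3 f) [0,0,0,Suc 0] p = 0"
    "symz 4 (cov \<mu> 3 f) [0,0,Suc 0,Suc 0] p = 0" "symz 4 (cov \<mu> 3 f) [0,Suc 0,Suc 0,Suc 0] p = 0"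
    "symz 4 (cov \<mu> 3 f) [Suc 0,Suc 0,Suc 0,Suc 0] p = 0"
    by (auto simp: idx_def)
  have Chr_table: "Chr \<mu> 0 0 0 p = dx \<mu> p" "Chr \<mu> 0 0 (Suc 0) p = dy \<mu> p" "Chr \<mu> 0 (Suc 0) 0 p = dy \<mu> p"
    "Chr \<mu> 0 (Suc 0) (Suc 0) p = - dx \<mu> p" "Chr \<mu> (Suc 0) 0 0 p = - dy \<mu> p" "Chr \<mu> (Suc 0) 0 (Suc 0) p = dx \<mu> p"
    "Chr \<mu> (Suc 0) (Suc 0) 0 p = dx \<mu> p" "Chr \<mu> (Suc 0) (Suc 0) (Suc 0) p = dy \<mu> p"
    by (simp_all add: Chr_conformal[OF \<mu>] pd_def)
  note cov_simps = cov_3 numeral_2_eq_2 lessThan_Suc Chr_table killing_3_symmetric[OF kill] pd_def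
  \<comment> \<open>By symmetry of \<open>f\<close> the covariant derivative depends only on the
    derivative index and on how many of the other indices are \<open>Suc 0\<close>, hence the eight
    values \<open>C0\<close> to \<open>C7\<close>.\<close>
  have C0: "cov \<mu> 3 f [0,0,0,0] p = dx F0 p - 3 * (dx \<mu> p * F0 p) + 3 * (dy \<mu> p * F1 p)"
    by (simp add: cov_simps F0_def F1_def)
  have C1: "cov \<mu> 3 f [Suc 0,0,0,0] p = dy F0 p - 3 * (dy \<mu> p * F0 p) - 3 * (dx \<mu> p * F1 p)"
    by (simp add: cov_simps F0_def F1_def)
  have C2: "cov \<mu> 3 f xs p = dx F1 p - 3 * (dx \<mu> p * F1 p) + 2 * (dy \<mu> p * F2 p) - dy \<mu> p * F0 p"
    if "xs \<in> {[0,0,0,Suc 0],[0,0,Suc 0,0],[0,Suc 0,0,0]}" for xs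
    using that by (auto simp: cov_simps F0_def F1_def F2_def)
  have C3: "cov \<mu> 3 f xs p = dy F1 p - 3 * (dy \<mu> p * F1 p) - 2 * (dx \<mu> p * F2 p) + dx \<mu> p * F0 p"
    if "xs \<in> {[Suc 0,0,0,Suc 0],[Suc 0,0,Suc 0,0],[Suc 0,Suc 0,0,0]}" for xs
    using that by (auto simp: cov_simps F0_def F1_def F2_def)
  have C4: "cov \<mu> 3 f xs p = dx F2 p - 3 * (dx \<mu> p * F2 p) + dy \<mu> p * F3 p - 2 * (dy \<mu> p * F1 p)"
    if "xs \<in> {[0,Suc 0,0,Suc 0],[0,0,Suc 0,Suc 0],[0,Suc 0,Suc 0,0]}" for xs
    using that by (auto simp: cov_simps F1_def F2_def F3_def)
  have C5: "cov \<mu> 3 f xs p = dy F2 p - 3 * (dy \<mu> p * F2 p) - dx \<mu> p * F3 p + 2 * (dx \<mu> p * F1 p)"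
    if "xs \<in> {[Suc 0,Suc 0,0,Suc 0],[Suc 0,0,Suc 0,Suc 0],[Suc 0,Suc 0,Suc 0,0]}" for xs
    using that by (auto simp: cov_simps F1_def F2_def F3_def)
  have C6: "cov \<mu> 3 f [0,Suc 0,Suc 0,Suc 0] p = dx F3 p - 3 * (dy \<mu> p * F2 p) - 3 * (dx \<mu> p * F3 p)"
    by (simp add: cov_simps F2_def F3_def)
  have C7: "cov \<mu> 3 f [Suc 0,Suc 0,Suc 0,Suc 0] p = dy F3 p + 3 * (dx \<mu> p * F2 p) - 3 * (dy \<mu> p * F3 p)"
    by (simp add: cov_simps F2_def F3_def)
  note C = C0 C1 C2 C3 C4 C5 C6 C7
  show "dx F0 p = 3 * dx \<mu> p * F0 p - 3 * dy \<mu> p * F1 p"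
    using S(1) by (simp add: symz_4 C) algebra
  show "dy F0 p + 3 * dx F1 p = 6 * dy \<mu> p * F0 p + 12 * dx \<mu> p * F1 p - 6 * dy \<mu> p * F2 p"
    using S(2) by (simp add: symz_4 C) algebra
  show "dx F2 p + dy F1 p = 5 * dx \<mu> p * F2 p + 5 * dy \<mu> p * F1 p - dy \<mu> p * F3 p - dx \<mu> p * F0 p"
    using S(3) by (simp add: symz_4 C) algebra
  show "dx F3 p + 3 * dy F2 p = 12 * dy \<mu> p * F2 p + 6 * dx \<mu> p * F3 p - 6 * dx \<mu> p * F1 p"
    using S(4) by (simp add: symz_4 C) algebra
  show "dy F3 p = 3 * dy \<mu> p * F3 p - 3 * dx \<mu> p * F2 p"
    using S(5) by (simp add: symz_4 C) algebra
qed

lemma killing_components: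
  assumes "killing \<mu> a b m f" "xs \<in> idx m"
  shows "smooth (f xs)" "periodic a b (f xs)"
  using assms unfolding killing_def by blast+

text \<open>The Levi-Civita connection is metric, so already the unsymmetrised derivative vanishes.
  This is the rank 2 factor in the reducible case.\<close>

lemma killing_metric:
  assumes \<mu>: "smooth \<mu>" and per: "periodic a b \<mu>"
  shows "killing \<mu> a b 2 (\<lambda>xs. gm \<mu> (xs ! 0) (xs ! 1))" (is "killing _ _ _ _ ?g")
proof -
  have "cov \<mu> 2 ?g [k,i,j] p = 0" if "k \<in> {0,Suc 0}" "i \<in> {0,Suc 0}" "j \<in> {0,Suc 0}" for k i j p
    unfolding cov_2 using that
    by (auto simp: numeral_2_eq_2 lessThan_Suc Chr_conformal[OF \<mu>] pd_def gm_def partial_simps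
        smooth_intros \<mu>)
  then have "symz (Suc 2) (cov \<mu> 2 ?g) xs = (\<lambda>p. 0)" if "xs \<in> idx (Suc 2)" for xs
    using that by (auto simp: idx_3 symz_3)
  moreover have "smooth (?g xs)" "periodic a b (?g xs)" for xs
    using \<mu> per by (cases "xs ! 0 = xs ! 1"; auto simp: gm_def smooth_intros periodic_def)+
  moreover have "?g ys = ?g xs" if "xs \<in> idx 2" "mset ys = mset xs" for xs ys
  proof -
    have "length ys = 2"
      using that mset_eq_length[OF that(2)] by (simp add: idx_def)
    then obtain i j where "ys = [i,j]"
      by (auto simp: numeral_2_eq_2 length_Suc_conv)
    then show ?thesis
      using that mset_eq_setD[OF that(2)] unfolding idx_2 by (auto simp: gm_def doubleton_eq_iff)
  qed
  ultimately show ?thesis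
    unfolding killing_def by blast
qed

text \<open>The covector is the constant field \<open>(w1, w2)\<close> with its index lowered. A
  constant field preserves the flat metric, so it preserves \<open>gm \<mu>\<close> once it
  annihilates \<open>\<mu>\<close>.\<close>

lemma killing_conformal_field:
  assumes \<mu>: "smooth \<mu>" and per: "periodic a b \<mu>"
    and inv: "\<And>p. w1 * dx \<mu> p + w2 * dy \<mu> p = 0"
  shows "killing \<mu> a b 1 (\<lambda>xs p. (if xs ! 0 = 0 then w1 else w2) * exp (2 * \<mu> p))"
    (is "killing _ _ _ _ ?w")
proof -
  have zero: "w1 * (dx \<mu> p * x) + w2 * (dy \<mu> p * x) = 0" for p x
    using inv[of p] by algebra
  \<comment> \<open>The diagonal components are multiples of \<open>inv\<close>; the off-diagonal
    sum cancels identically.\<close>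
  have "cov \<mu> 1 ?w [0,0] p = 0" "cov \<mu> 1 ?w [Suc 0,Suc 0] p = 0"
    "cov \<mu> 1 ?w [0,Suc 0] p + cov \<mu> 1 ?w [Suc 0,0] p = 0" for p
    using zero[of p "exp (2 * \<mu> p)"] unfolding cov_1
    by (simp_all add: numeral_2_eq_2 lessThan_Suc Chr_conformal[OF \<mu>] pd_def partial_simps
        smooth_intros \<mu> algebra_simps)
  moreover define C where "C = cov \<mu> 1 ?w"
  ultimately have "symz 2 C xs p = 0" if "xs \<in> idx 2" for xs p
    using that unfolding idx_2 by (elim insertE emptyE) (simp_all only: symz_2 add.commute, simp_all)
  then have "symz (Suc 1) (cov \<mu> 1 ?w) xs = (\<lambda>p. 0)" if "xs \<in> idx (Suc 1)" for xs
    using that unfolding Suc_1 C_def by blast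
  moreover have "smooth (?w xs)" "periodic a b (?w xs)" for xs
    using \<mu> per by (auto simp: smooth_intros periodic_def)
  moreover have "?w ys = ?w xs" if "xs \<in> idx 1" "mset ys = mset xs" for xs ys
    using that unfolding idx_1 by auto
  ultimately show ?thesis
    unfolding killing_def by blast
qed

subsection \<open>The Killing equations in rank three\<close>

text \<open>\<open>e\<close> and \<open>l\<close> are 1/lambda and lambda. With the exponentials
  folded away, the computations become polynomial identities modulo \<open>el\<close>.\<close>

context
  fixes \<mu> :: "real \<times> real \<Rightarrow> real" and e l :: "real \<times> real \<Rightarrow> real"
  assumes \<mu>: "smooth \<mu>"
  defines "e \<equiv> \<lambda>p. exp (- 2 * \<mu> p)" and "l \<equiv> \<lambda>p. exp (2 * \<mu> p)"
begin

lemma smooth_el: "smooth e" "smooth l"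
  unfolding e_def l_def by (intro smooth_intros smooth_const \<mu>)+

lemma el: "e p * l p = 1"
  by (simp add: e_def l_def flip: exp_add)

lemma d_el: "dx e = (\<lambda>p. - 2 * dx \<mu> p * e p)" "dy e = (\<lambda>p. - 2 * dy \<mu> p * e p)"
  "dx l = (\<lambda>p. 2 * dx \<mu> p * l p)" "dy l = (\<lambda>p. 2 * dy \<mu> p * l p)"
  unfolding e_def l_def by (simp_all add: partial_simps smooth_intros \<mu>)

text \<open>In the complex notation of the header, \<open>P + iQ = 4 \<lambda> (u\<^bsub>zbar\<^esub> / \<lambda>)\<^bsub>zbar\<^esub>\<close> is the trace-free part of the Hessian
  of \<open>u\<close> and \<open>S + iT\<close> its divergence; the operators of the theorem are the real and imaginary part of
  a second divergence.\<close>

lemma trace_free_Hessian_divergence: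
  fixes u
  defines "P \<equiv> \<lambda>p. dx (dx u) p - dy (dy u) p - 2 * dx \<mu> p * dx u p + 2 * dy \<mu> p * dy u p"
    and "Q \<equiv> \<lambda>p. 2 * dy (dx u) p - 2 * dy \<mu> p * dx u p - 2 * dx \<mu> p * dy u p"
    and "S \<equiv> \<lambda>p. dx (lap \<mu> u) p + 2 * gauss_curv \<mu> p * dx u p"
    and "T \<equiv> \<lambda>p. dy (lap \<mu> u) p + 2 * gauss_curv \<mu> p * dy u p"
  assumes u: "smooth u"
  shows "e p * (dx P p + dy Q p) = S p" "e p * (dx Q p - dy P p) = T p"
    "dx S p + dy T p = l p * (lap \<mu> (lap \<mu> u) p + 2 * div_K_grad \<mu> u p)"
    "dx T p - dy S p = 2 * l p * perp_grad_K \<mu> u p"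
proof -
  have lap: "lap \<mu> v = (\<lambda>p. e p * (dx (dx v) p + dy (dy v) p))" for v
    by (simp add: lap_def e_def)
  have K: "gauss_curv \<mu> = (\<lambda>p. - e p * (dx (dx \<mu>) p + dy (dy \<mu>) p))"
    by (simp add: gauss_curv_def e_def)
  note simps = partial_simps smooth_intros mixed_partials smooth_el \<mu> u
  \<comment> \<open>The third derivatives of \<open>u\<close> and the derivatives of
    \<open>e\<close> combine to the differential of \<open>lap \<mu> u\<close>; the second
    derivatives of \<open>\<mu>\<close> combine to the curvature term.\<close>
  show "e p * (dx P p + dy Q p) = S p"
    by (simp add: P_def Q_def S_def lap K simps d_el algebra_simps)
  show "e p * (dx Q p - dy P p) = T p"
    by (simp add: P_def Q_def T_def lap K simps d_el algebra_simps)
  have sm: "smooth (lap \<mu> u)" "smooth (gauss_curv \<mu>)"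
    unfolding lap K by (intro simps)+
  have "dx S p + dy T p = dx (dx (lap \<mu> u)) p + dy (dy (lap \<mu> u)) p +
      2 * (dx (\<lambda>q. gauss_curv \<mu> q * dx u q) p + dy (\<lambda>q. gauss_curv \<mu> q * dy u q) p)"
    by (simp add: S_def T_def simps sm algebra_simps)
  moreover have "div_K_grad \<mu> u p = e p * (dx (\<lambda>q. gauss_curv \<mu> q * dx u q) p + dy (\<lambda>q. gauss_curv \<mu> q * dy u q) p)"
    by (simp add: div_K_grad_def e_def)
  ultimately show "dx S p + dy T p = l p * (lap \<mu> (lap \<mu> u) p + 2 * div_K_grad \<mu> u p)"
    using el[of p] unfolding lap[of "lap \<mu> u"] by algebra
  \<comment> \<open>The curl annihilates the gradient of \<open>lap \<mu> u\<close> and leaves only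
    products of first derivatives of the curvature and of \<open>u\<close>.\<close>
  have "dx T p - dy S p = 2 * (- dy (gauss_curv \<mu>) p * dx u p + dx (gauss_curv \<mu>) p * dy u p)"
    by (simp add: S_def T_def simps sm algebra_simps)
  moreover have "perp_grad_K \<mu> u p = e p * (- dy (gauss_curv \<mu>) p * dx u p + dx (gauss_curv \<mu>) p * dy u p)"
    by (simp add: perp_grad_K_def e_def)
  ultimately show "dx T p - dy S p = 2 * l p * perp_grad_K \<mu> u p"
    using el[of p] by algebra
qed

text \<open>With \<open>A = A1 + i A2\<close> the hypotheses read
  \<open>P + iQ = - 4 i A lambda^2 \<mu>_z\<close>. Both divergences of
  \<open>trace_free_Hessian_divergence\<close> are applied to this equation.\<close>

lemma Lam_system:
  fixes u and A1 A2 :: real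
  assumes u: "smooth u"
    and eqP: "\<And>p. dx (dx u) p - dy (dy u) p - 2 * dx \<mu> p * dx u p + 2 * dy \<mu> p * dy u p
      = 2 * (l p * l p) * (A2 * dx \<mu> p - A1 * dy \<mu> p)"
    and eqQ: "\<And>p. 2 * dy (dx u) p - 2 * dy \<mu> p * dx u p - 2 * dx \<mu> p * dy u p
      = - 2 * (l p * l p) * (A1 * dx \<mu> p + A2 * dy \<mu> p)"
  shows "perp_grad_K \<mu> u p = - A1 * Lam1 \<mu> p + - A2 * Lam2 \<mu> p"
    "1 / 2 * lap \<mu> (lap \<mu> u) p + div_K_grad \<mu> u p = A2 * Lam1 \<mu> p - A1 * Lam2 \<mu> p"
proof -
  define P where "P = (\<lambda>p. dx (dx u) p - dy (dy u) p - 2 * dx \<mu> p * dx u p + 2 * dy \<mu> p * dy u p)"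
  define Q where "Q = (\<lambda>p. 2 * dy (dx u) p - 2 * dy \<mu> p * dx u p - 2 * dx \<mu> p * dy u p)"
  define S where "S = (\<lambda>p. dx (lap \<mu> u) p + 2 * gauss_curv \<mu> p * dx u p)"
  define T where "T = (\<lambda>p. dy (lap \<mu> u) p + 2 * gauss_curv \<mu> p * dy u p)"
  \<comment> \<open>\<open>m - i n = lambda^(-2) (lambda^2)_zz\<close>; the first divergence turns
    the right-hand side into \<open>S + iT = - 2 i A lambda (m - i n)\<close>.\<close>
  define m where "m = (\<lambda>p. dx (dx \<mu>) p - dy (dy \<mu>) p + 4 * (dx \<mu> p * dx \<mu> p) - 4 * (dy \<mu> p * dy \<mu> p))"
  define n where "n = (\<lambda>p. 2 * dy (dx \<mu>) p + 8 * (dx \<mu> p * dy \<mu> p))"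
  have TF: "e p * (dx P p + dy Q p) = S p" "e p * (dx Q p - dy P p) = T p"
    "dx S p + dy T p = l p * (lap \<mu> (lap \<mu> u) p + 2 * div_K_grad \<mu> u p)"
    "dx T p - dy S p = 2 * l p * perp_grad_K \<mu> u p" for p
    unfolding P_def Q_def S_def T_def by (rule trace_free_Hessian_divergence[OF u])+
  note simps = partial_simps smooth_intros mixed_partials smooth_el \<mu> d_el
  have PQ: "P = (\<lambda>p. 2 * (l p * l p) * (A2 * dx \<mu> p - A1 * dy \<mu> p))"
    "Q = (\<lambda>p. - 2 * (l p * l p) * (A1 * dx \<mu> p + A2 * dy \<mu> p))"
    unfolding P_def Q_def using eqP eqQ by auto
  have "dx P q + dy Q q = 2 * (l q * l q) * (A2 * m q - A1 * n q)"
    "dx Q q - dy P q = - 2 * (l q * l q) * (A1 * m q + A2 * n q)" for q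
    unfolding PQ m_def n_def by (simp_all add: simps algebra_simps)
  note dPQ = this
  have "S q = 2 * l q * (A2 * m q - A1 * n q)" for q
    unfolding TF(1)[symmetric] dPQ using el[of q] by algebra
  moreover have "T q = - 2 * l q * (A1 * m q + A2 * n q)" for q
    unfolding TF(2)[symmetric] dPQ using el[of q] by algebra
  ultimately have ST: "S = (\<lambda>q. 2 * l q * (A2 * m q - A1 * n q))" "T = (\<lambda>q. - 2 * l q * (A1 * m q + A2 * n q))"
    by auto
  have smn: "smooth m" "smooth n"
    unfolding m_def n_def by (intro smooth_intros smooth_const \<mu>)+
  \<comment> \<open>In complex form,
    \<open>Lam1 - i Lam2 = 2 lambda^(-1) (lambda (m - i n))_z\<close>, which is what the second
    divergence produces.\<close>
  have Lam: "Lam1 \<mu> p = dx m p + 2 * dx \<mu> p * m p - dy n p - 2 * dy \<mu> p * n p"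
    "Lam2 \<mu> p = dy m p + 2 * dy \<mu> p * m p + dx n p + 2 * dx \<mu> p * n p"
    unfolding m_def n_def Lam1_def Lam2_def
    by (simp_all add: simps algebra_simps power2_eq_square power3_eq_cube)
  have "dx S p + dy T p = 2 * l p * (A2 * Lam1 \<mu> p - A1 * Lam2 \<mu> p)"
    "dx T p - dy S p = 2 * l p * (- A1 * Lam1 \<mu> p - A2 * Lam2 \<mu> p)"
    unfolding ST Lam by (simp_all add: simps smn algebra_simps)
  moreover have "l p \<noteq> 0" by (simp add: l_def)
  ultimately show "perp_grad_K \<mu> u p = - A1 * Lam1 \<mu> p + - A2 * Lam2 \<mu> p"
    "1 / 2 * lap \<mu> (lap \<mu> u) p + div_K_grad \<mu> u p = A2 * Lam1 \<mu> p - A1 * Lam2 \<mu> p"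
    using TF(3,4)[of p] by auto
qed

text \<open>The two functions are, up to the factor \<open>\<lambda>\<^sup>3\<close>, the real and imaginary part of the leading coefficient \<open>A\<close>.\<close>

lemma killing_3_constants:
  fixes f a b
  defines "F0 \<equiv> f [0,0,0]" and "F1 \<equiv> f [0,0,Suc 0]" and "F2 \<equiv> f [0,Suc 0,Suc 0]"
    and "F3 \<equiv> f [Suc 0,Suc 0,Suc 0]"
  assumes lat: "lattice_basis a b" and per: "periodic a b \<mu>" and kill: "killing \<mu> a b 3 f"
  obtains A1 A2 where "\<And>p. F0 p - 3 * F2 p = A1 * (l p * l p * l p)" "\<And>p. 3 * F1 p - F3 p = A2 * (l p * l p * l p)"
proof -
  have F: "smooth F0" "smooth F1" "smooth F2" "smooth F3"
    "periodic a b F0" "periodic a b F1" "periodic a b F2" "periodic a b F3"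
    using killing_components[OF kill] unfolding F0_def F1_def F2_def F3_def by (simp_all add: idx_3)
  note eqs = killing_3_equations[OF \<mu> kill, folded F0_def F1_def F2_def F3_def]
  note simps = partial_simps smooth_intros smooth_el \<mu> d_el F
  \<comment> \<open>Raising three indices contributes \<open>e^3\<close>, so \<open>P + iQ\<close>
    is the coefficient \<open>A\<close> of \<open>p^3\<close>; \<open>CR\<close> below is
    \<open>A_zbar = 0\<close>.\<close>
  define P where "P = (\<lambda>p. e p * e p * e p * (F0 p - 3 * F2 p))"
  define Q where "Q = (\<lambda>p. e p * e p * e p * (3 * F1 p - F3 p))"
  have sm: "smooth P" "smooth Q"
    unfolding P_def Q_def by (intro simps smooth_const)+
  have per: "periodic a b P" "periodic a b Q"
    using per F(5-8) by (simp_all add: periodic_def P_def Q_def e_def)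
  have CR: "dx P p = dy Q p" "dx Q p = - dy P p" for p
    using eqs[of p] unfolding P_def Q_def by (simp_all add: simps) algebra+
  obtain A1 A2 where A: "P = (\<lambda>p. A1)" "Q = (\<lambda>p. A2)"
    using periodic_Cauchy_Riemann_constant[OF lat sm(1) per(1) sm(2) per(2) CR] by blast
  have PQ: "P p = A1" "Q p = A2" for p
    using A by simp_all
  have cancel: "x = e p * e p * e p * x * (l p * l p * l p)" for x p
    using el[of p] by algebra
  have "F0 p - 3 * F2 p = A1 * (l p * l p * l p)" for p
    using cancel[of "F0 p - 3 * F2 p" p] PQ(1)[of p] unfolding P_def by simp
  moreover have "3 * F1 p - F3 p = A2 * (l p * l p * l p)" for p
    using cancel[of "3 * F1 p - F3 p" p] PQ(2)[of p] unfolding Q_def by simp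
  ultimately show thesis
    by (rule that)
qed

text \<open>The coefficient of \<open>p^2 pbar\<close> defines a closed one-form with potential
  \<open>u\<close>; the other Killing equations, with \<open>A\<close> constant, prescribe the
  trace-free Hessian of \<open>u\<close>.\<close>

lemma killing_3_potential:
  fixes f a b
  defines "F0 \<equiv> f [0,0,0]" and "F1 \<equiv> f [0,0,Suc 0]" and "F2 \<equiv> f [0,Suc 0,Suc 0]"
    and "F3 \<equiv> f [Suc 0,Suc 0,Suc 0]"
  assumes per: "periodic a b \<mu>" and kill: "killing \<mu> a b 3 f"
    and A1: "\<And>p. F0 p - 3 * F2 p = A1 * (l p * l p * l p)"
    and A2: "\<And>p. 3 * F1 p - F3 p = A2 * (l p * l p * l p)"
  shows "\<exists>u. smooth u \<and> periodic a b (dx u) \<and> periodic a b (dy u) \<and>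
    (\<forall>p. dx (dx u) p - dy (dy u) p - 2 * dx \<mu> p * dx u p + 2 * dy \<mu> p * dy u p
      = 2 * (l p * l p) * (A2 * dx \<mu> p - A1 * dy \<mu> p)) \<and>
    (\<forall>p. 2 * dy (dx u) p - 2 * dy \<mu> p * dx u p - 2 * dx \<mu> p * dy u p
      = - 2 * (l p * l p) * (A1 * dx \<mu> p + A2 * dy \<mu> p))"
proof -
  have F: "smooth F0" "smooth F1" "smooth F2" "smooth F3"
    "periodic a b F0" "periodic a b F1" "periodic a b F2" "periodic a b F3"
    using killing_components[OF kill] unfolding F0_def F1_def F2_def F3_def by (simp_all add: idx_3)
  note eqs = killing_3_equations[OF \<mu> kill, folded F0_def F1_def F2_def F3_def]
  note simps = partial_simps smooth_intros smooth_el \<mu> d_el F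
  have A: "(\<lambda>p. F0 p - 3 * F2 p) = (\<lambda>p. A1 * (l p * l p * l p))" "(\<lambda>p. 3 * F1 p - F3 p) = (\<lambda>p. A2 * (l p * l p * l p))"
    using A1 A2 by auto
  have dA: "dx F0 p - 3 * dx F2 p = 6 * dx \<mu> p * (F0 p - 3 * F2 p)"
    "dy F0 p - 3 * dy F2 p = 6 * dy \<mu> p * (F0 p - 3 * F2 p)"
    "3 * dx F1 p - dx F3 p = 6 * dx \<mu> p * (3 * F1 p - F3 p)"
    "3 * dy F1 p - dy F3 p = 6 * dy \<mu> p * (3 * F1 p - F3 p)" for p
    unfolding A1 A2
    using A[THEN arg_cong[where f = "\<lambda>h. dx h p"]] A[THEN arg_cong[where f = "\<lambda>h. dy h p"]]
    by (simp_all add: simps algebra_simps)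
  have eA: "e p * (F0 p - 3 * F2 p) = A1 * (l p * l p)" "e p * (3 * F1 p - F3 p) = A2 * (l p * l p)" for p
    unfolding A1 A2 using el[of p] by algebra+
  \<comment> \<open>The last Killing equation says that \<open>(U, - V)\<close> is divergence free, i.e. \<open>V dx + U dy\<close> is closed.\<close>
  define U where "U = (\<lambda>p. e p * (F0 p + F2 p))"
  define V where "V = (\<lambda>p. - e p * (F1 p + F3 p))"
  have sm: "smooth U" "smooth V"
    unfolding U_def V_def by (intro simps)+
  have "dy V p = dx U p" for p
    using eqs[of p] unfolding U_def V_def by (simp add: simps) algebra
  then obtain u where u: "smooth u" "dx u = V" "dy u = U"
    using closed_form_potential[OF sm(2,1)] by blast
  \<comment> \<open>Periodicity is claimed for the form only; its potential may change by constants
    along the lattice.\<close>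
  have "periodic a b V" "periodic a b U"
    using per F(5-8) by (simp_all add: periodic_def U_def V_def e_def)
  moreover have "dx V p - dy U p - 2 * dx \<mu> p * V p + 2 * dy \<mu> p * U p
      = 2 * (l p * l p) * (A2 * dx \<mu> p - A1 * dy \<mu> p)" for p
  proof -
    \<comment> \<open>This combines the second and fourth Killing equations with
      \<open>dA\<close>.\<close>
    have "dx F1 p + dx F3 p + dy F0 p + dy F2 p = 4 * dx \<mu> p * (F1 p + F3 p) + 4 * dy \<mu> p * (F0 p + F2 p)
       - 2 * dx \<mu> p * (3 * F1 p - F3 p) + 2 * dy \<mu> p * (F0 p - 3 * F2 p)"
      using eqs[of p] dA[of p] by (simp add: algebra_simps)
    then have "dx V p - dy U p - 2 * dx \<mu> p * V p + 2 * dy \<mu> p * U p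
        = 2 * dx \<mu> p * (e p * (3 * F1 p - F3 p)) - 2 * dy \<mu> p * (e p * (F0 p - 3 * F2 p))"
      unfolding U_def V_def by (simp add: simps) algebra
    then show ?thesis
      unfolding eA by (simp add: algebra_simps)
  qed
  moreover have "2 * dy V p - 2 * dy \<mu> p * V p - 2 * dx \<mu> p * U p
      = - 2 * (l p * l p) * (A1 * dx \<mu> p + A2 * dy \<mu> p)" for p
  proof -
    \<comment> \<open>The fifth Killing equation gives \<open>dy F3\<close>, and \<open>dA\<close>
      then gives \<open>dy F1\<close>.\<close>
    have "dy F1 p + dy F3 p = 3 * dy \<mu> p * (F1 p + F3 p) - dx \<mu> p * (F0 p + F2 p)
       + dx \<mu> p * (F0 p - 3 * F2 p) + dy \<mu> p * (3 * F1 p - F3 p)"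
      using eqs[of p] dA[of p] by (simp add: algebra_simps)
    moreover have "2 * dy V p - 2 * dy \<mu> p * V p - 2 * dx \<mu> p * U p = e p *
        (6 * dy \<mu> p * (F1 p + F3 p) - 2 * (dy F1 p + dy F3 p) - 2 * dx \<mu> p * (F0 p + F2 p))"
      unfolding U_def V_def by (simp add: simps algebra_simps)
    ultimately have "2 * dy V p - 2 * dy \<mu> p * V p - 2 * dx \<mu> p * U p
        = - 2 * dx \<mu> p * (e p * (F0 p - 3 * F2 p)) - 2 * dy \<mu> p * (e p * (3 * F1 p - F3 p))"
      by (simp only:) (simp add: algebra_simps)
    then show ?thesis
      unfolding eA by (simp add: algebra_simps)
  qed
  ultimately show ?thesis
    using u by (intro exI[of _ u]) simp
qed

text \<open>The hypotheses \<open>F0\<close> and \<open>F3\<close> say \<open>A = 0\<close>. Then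
  \<open>lambda B\<close> is a constant field by Liouville, the rest of the Killing equation makes
  it preserve the metric, and \<open>f\<close> is its symmetric product with the metric.\<close>

lemma killing_3_reducible:
  fixes f a b
  defines "F0 \<equiv> f [0,0,0]" and "F1 \<equiv> f [0,0,Suc 0]" and "F2 \<equiv> f [0,Suc 0,Suc 0]"
    and "F3 \<equiv> f [Suc 0,Suc 0,Suc 0]"
  assumes lat: "lattice_basis a b" and per: "periodic a b \<mu>" and kill: "killing \<mu> a b 3 f"
    and F0: "\<And>p. F0 p = 3 * F2 p" and F3: "\<And>p. F3 p = 3 * F1 p"
  shows "\<not> irreducible_killing3 \<mu> a b f"
proof -
  have F: "smooth F1" "smooth F2" "periodic a b F1" "periodic a b F2"
    using killing_components[OF kill] unfolding F1_def F2_def by (simp_all add: idx_3)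
  note simps = partial_simps smooth_intros smooth_el \<mu> d_el F
  have F03: "F0 = (\<lambda>p. 3 * F2 p)" "F3 = (\<lambda>p. 3 * F1 p)"
    using F0 F3 by auto
  have d03: "dx F0 p = 3 * dx F2 p" "dy F0 p = 3 * dy F2 p" "dx F3 p = 3 * dx F1 p" "dy F3 p = 3 * dy F1 p" for p
    unfolding F03 by (simp_all add: simps)
  note eqs = killing_3_equations[OF \<mu> kill, folded F0_def F1_def F2_def F3_def, unfolded d03 F0 F3]
  \<comment> \<open>Since \<open>A = 0\<close>, the second coefficient, a multiple of \<open>P + iQ\<close> after rescaling, is holomorphic too.\<close>
  define P where "P = (\<lambda>p. e p * e p * F2 p)"
  define Q where "Q = (\<lambda>p. e p * e p * F1 p)"
  have sm: "smooth P" "smooth Q"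
    unfolding P_def Q_def by (intro simps)+
  have perPQ: "periodic a b P" "periodic a b Q"
    using per F by (simp_all add: periodic_def P_def Q_def e_def)
  have "dx F2 p - dy F1 p = 4 * dx \<mu> p * F2 p - 4 * dy \<mu> p * F1 p"
    "dx F1 p + dy F2 p = 4 * dx \<mu> p * F1 p + 4 * dy \<mu> p * F2 p" for p
    using eqs[of p] by (simp_all add: algebra_simps)
  note CR' = this
  have CR: "dx P p = dy Q p" "dx Q p = - dy P p" for p
    using CR'[of p] unfolding P_def Q_def by (simp_all add: simps) algebra+
  obtain g1 g2 where A: "P = (\<lambda>p. g1)" "Q = (\<lambda>p. g2)"
    using periodic_Cauchy_Riemann_constant[OF lat sm(1) perPQ(1) sm(2) perPQ(2) CR] by blast
  have PQ: "P p = g1" "Q p = g2" for p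
    using A by simp_all
  have cancel: "x = e p * e p * x * (l p * l p)" for x p
    using el[of p] by algebra
  have "F2 p = g1 * (l p * l p)" "F1 p = g2 * (l p * l p)" for p
    using cancel[of "F2 p" p] cancel[of "F1 p" p] PQ[of p] unfolding P_def Q_def by simp_all
  then have F12: "F2 = (\<lambda>p. g1 * (l p * l p))" "F1 = (\<lambda>p. g2 * (l p * l p))"
    by auto
  \<comment> \<open>For constant \<open>g1\<close>, \<open>g2\<close> the first Killing equation
    reduces to the Killing condition on the field \<open>(g1, g2)\<close>.\<close>
  have "g1 * dx \<mu> p + g2 * dy \<mu> p = 0" for p
  proof -
    have "l p * l p * (g1 * dx \<mu> p + g2 * dy \<mu> p) = 0"
      using eqs(1)[of p] unfolding F12 by (simp add: simps algebra_simps)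
    then show ?thesis by (simp add: l_def)
  qed
  then have inv: "3 * g1 * dx \<mu> p + 3 * g2 * dy \<mu> p = 0" for p
    by (metis distrib_left mult.assoc mult_zero_right)
  define g :: tfield where "g = (\<lambda>xs. gm \<mu> (xs ! 0) (xs ! 1))"
  \<comment> \<open>The factor 3 offsets the symmetrisation: the metric is diagonal, so in a mixed
    component such as \<open>[0,0,Suc 0]\<close> only a third of the terms contribute.\<close>
  define w :: tfield where "w = (\<lambda>xs p. (if xs ! 0 = 0 then 3 * g1 else 3 * g2) * exp (2 * \<mu> p))"
  have "killing \<mu> a b 2 g" "killing \<mu> a b 1 w"
    unfolding g_def w_def using killing_metric[OF \<mu> per] killing_conformal_field[OF \<mu> per inv] by auto
  then have "killing_product \<mu> a b [(2,g),(1,w)]"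
    by (simp add: killing_product_def)
  moreover have sprod: "sprod (2,g) (1,w) = (3, symz 3 (tprod 2 g w))"
    by (simp add: sprod_def)
  moreover have "f xs p = symz 3 (tprod 2 g w) xs p" if "xs \<in> idx 3" for xs p
  proof -
    have "f [0,0,0] p = 3 * g1 * (l p * l p)" "f [0,0,Suc 0] p = g2 * (l p * l p)"
      "f [0,Suc 0,Suc 0] p = g1 * (l p * l p)" "f [Suc 0,Suc 0,Suc 0] p = 3 * g2 * (l p * l p)"
      using F03 F12 unfolding F0_def F1_def F2_def F3_def by auto
    then show ?thesis
      using that
      by (auto simp: idx_3 symz_3 tprod_def g_def w_def gm_def l_def killing_3_symmetric[OF kill])
  qed
  ultimately show ?thesis
    unfolding irreducible_killing3_def by (auto intro!: exI[of _ "[[(2,g),(1,w)]]"])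
qed

end

theorem theorem4p3:
  fixes \<mu> :: "real \<times> real \<Rightarrow> real" and a b :: "real \<times> real" and f :: tfield
  assumes "lattice_basis a b"
    and "smooth \<mu>" and "periodic a b \<mu>"
    and "irreducible_killing3 \<mu> a b f"
  shows "\<exists>c1 c2 :: real. (c1, c2) \<noteq> (0, 0) \<and>
          (\<exists>u. smooth u \<and> periodic a b (dx u) \<and> periodic a b (dy u) \<and>
            (\<forall>p. perp_grad_K \<mu> u p = c1 * Lam1 \<mu> p + c2 * Lam2 \<mu> p) \<and>
            (\<forall>p. (1/2) * lap \<mu> (lap \<mu> u) p + div_K_grad \<mu> u p
                   = - c2 * Lam1 \<mu> p + c1 * Lam2 \<mu> p))"
proof -
  note lat = assms(1) and \<mu> = assms(2) and per = assms(3)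
  have kill: "killing \<mu> a b 3 f"
    using assms(4) by (simp add: irreducible_killing3_def)
  obtain A1 A2 where
    A1: "\<And>p. f [0,0,0] p - 3 * f [0,Suc 0,Suc 0] p = A1 * (exp (2 * \<mu> p) * exp (2 * \<mu> p) * exp (2 * \<mu> p))" and
    A2: "\<And>p. 3 * f [0,0,Suc 0] p - f [Suc 0,Suc 0,Suc 0] p = A2 * (exp (2 * \<mu> p) * exp (2 * \<mu> p) * exp (2 * \<mu> p))"
    using killing_3_constants[OF \<mu> lat per kill] by blast
  obtain u where u: "smooth u" "periodic a b (dx u)" "periodic a b (dy u)"
    and PQ: "\<And>p. dx (dx u) p - dy (dy u) p - 2 * dx \<mu> p * dx u p + 2 * dy \<mu> p * dy u p
      = 2 * (exp (2 * \<mu> p) * exp (2 * \<mu> p)) * (A2 * dx \<mu> p - A1 * dy \<mu> p)"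
    "\<And>p. 2 * dy (dx u) p - 2 * dy \<mu> p * dx u p - 2 * dx \<mu> p * dy u p
      = - 2 * (exp (2 * \<mu> p) * exp (2 * \<mu> p)) * (A1 * dx \<mu> p + A2 * dy \<mu> p)"
    using killing_3_potential[OF \<mu> per kill A1 A2] by blast
  \<comment> \<open>Irreducibility, beyond the Killing equation itself, enters here.\<close>
  have "(- A1, - A2) \<noteq> (0, 0)"
  proof
    assume "(- A1, - A2) = (0, 0)"
    then have "f [0,0,0] p = 3 * f [0,Suc 0,Suc 0] p" "f [Suc 0,Suc 0,Suc 0] p = 3 * f [0,0,Suc 0] p" for p
      using A1[of p] A2[of p] by auto
    then show False
      using killing_3_reducible[OF \<mu> lat per kill] assms(4) by blast
  qed
  with u Lam_system[OF \<mu> u(1) PQ] show ?thesis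
    by (intro exI[of _ "- A1"] exI[of _ "- A2"] conjI exI[of _ u]) auto
qed

end
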